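(* Let $G$ and $H$ be sequent calculi such that $G$ is a set of strongly focused axioms, $H$ extends $\mathbf{MALL}$, and every sequent of $G$ is provable in $H$. Then $G$ has $H$-monotone feasible interpolation.
   Context: Language: classical propositional language with fusion, addition, $1$, $0$ read as $\wedge,\vee,\top,\bot$; $V(\cdot)$ = atoms (for meta-formulas also formula variables). Multi-conclusion sequents $\Gamma\Rightarrow\Delta$ with finite multisets. $\mathbf{MALL}$: multi-conclusion calculus with axioms $\phi\Rightarrow\phi$, $\Rightarrow1$, $0\Rightarrow$, $\Gamma\Rightarrow\top,\Delta$, $\Gamma,\bot\Rightarrow\Delta$ and the standard multi-conclusion rules for $1,0,\wedge,\vee,*,+$ (i.e. $\mathbf{CFL_e}$ without implication rules); $H$ extends $\mathbf{MALL}$ if every $\mathbf{MALL}$-provable sequent is $H$-provable. Strongly focused axioms: $\phi\Rightarrow\phi$; $\Rightarrow\bar\alpha$; $\bar\beta\Rightarrow$; $\Gamma,\bar\phi\Rightarrow\Delta$; $\Gamma\Rightarrow\bar\phi,\Delta$, where $\bar\alpha$ (second form) and $\bar\phi$ (fifth form) contain no variables, and $\Gamma,\Delta$ are meta-multiset variables. A formula is monotone if all atom occurrences are positive (not under negation nor in the antecedent of an implication); a multiset is monotone if all its elements are. $G$ has $H$-monotone feasible interpolation if for every $k$ and every sequent $\Sigma\Rightarrow\Lambda_1,\dots,\Lambda_k$ (succedent split into multisets $\Lambda_j$) with a tree-like $G$-proof $\pi$ there are formulas $C_1,\dots,C_k$ with $|C_j|\le|\pi|^{O(1)}$, $H\vdash\Sigma\Rightarrow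 C_1,\dots,C_k$, $H\vdash C_j\Rightarrow\Lambda_j$, $V(C_j)\subseteq V(\Sigma)\cap V(\Lambda_j)$, and each $C_j$ monotone whenever $\Sigma$ is monotone.
   Formalization: "H extends MALL" is strengthened: the H-provable sequents must also be closed under the MALL rules; with mere inclusion of MALL-provable sequents the claim fails (e.g. G = {p ⇒}, H = all MALL-provable sequents plus p ⇒ as axioms, without rules). *)

theory Defs
  imports "HOL-Library.Multiset"
begin

text \<open>
  Connectives carry a mode. With two distinct modes one obtains the language with
  \<open>\<and>, \<or>, \<top>, \<bottom>\<close> (additive) and \<open>*, +, 1, 0\<close> (multiplicative) as separate symbols. With a single
  mode one obtains the plain classical language, in which \<open>*, +, 1, 0\<close> are literally read as
  \<open>\<and>, \<or>, \<top>, \<bottom>\<close>. Everything below is uniform in the two readings.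
\<close>

class mode =
  fixes additive :: 'a and multiplicative :: 'a
  assumes modes: "UNIV = {additive, multiplicative}"

datatype two_modes = Additive | Multiplicative

instantiation two_modes :: mode
begin
definition "additive = Additive"
definition "multiplicative = Multiplicative"
instance
  by standard
    (metis UNIV_eq_I additive_two_modes_def insertI1 insert_subset
      multiplicative_two_modes_def subset_insertI two_modes.exhaust)
end

instantiation unit :: mode
begin
definition "additive = ()"
definition "multiplicative = ()"
instance by standard auto
end

datatype ('a, 'm) fm =
    Atom 'a
  | TopM 'm
  | BotM 'm
  | Neg "('a, 'm) fm"
  | ConM 'm "('a, 'm) fm" "('a, 'm) fm"
  | DisM 'm "('a, 'm) fm" "('a, 'm) fm"
  | Imp "('a, 'm) fm" "('a, 'm) fm"

abbreviation Top :: "('a, 'm::mode) fm" where "Top \<equiv> TopM additive"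
abbreviation Bot :: "('a, 'm::mode) fm" where "Bot \<equiv> BotM additive"
abbreviation One :: "('a, 'm::mode) fm" where "One \<equiv> TopM multiplicative"
abbreviation Zero :: "('a, 'm::mode) fm" where "Zero \<equiv> BotM multiplicative"
abbreviation And :: "('a, 'm::mode) fm \<Rightarrow> ('a, 'm) fm \<Rightarrow> ('a, 'm) fm"
  where "And \<equiv> ConM additive"
abbreviation Or :: "('a, 'm::mode) fm \<Rightarrow> ('a, 'm) fm \<Rightarrow> ('a, 'm) fm"
  where "Or \<equiv> DisM additive"
abbreviation Fusion :: "('a, 'm::mode) fm \<Rightarrow> ('a, 'm) fm \<Rightarrow> ('a, 'm) fm"
  where "Fusion \<equiv> ConM multiplicative"
abbreviation Plus :: "('a, 'm::mode) fm \<Rightarrow> ('a, 'm) fm \<Rightarrow> ('a, 'm) fm"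
  where "Plus \<equiv> DisM multiplicative"

primrec V :: "('a, 'm) fm \<Rightarrow> 'a set" where
  "V (Atom p) = {p}"
| "V (TopM m) = {}"
| "V (BotM m) = {}"
| "V (Neg A) = V A"
| "V (ConM m A B) = V A \<union> V B"
| "V (DisM m A B) = V A \<union> V B"
| "V (Imp A B) = V A \<union> V B"

definition V_mset :: "('a, 'm) fm multiset \<Rightarrow> 'a set" where
  "V_mset \<Gamma> = (\<Union>A\<in>set_mset \<Gamma>. V A)"

primrec fm_size :: "('a, 'm) fm \<Rightarrow> nat" where
  "fm_size (Atom p) = 1"
| "fm_size (TopM m) = 1"
| "fm_size (BotM m) = 1"
| "fm_size (Neg A) = fm_size A + 1"
| "fm_size (ConM m A B) = fm_size A + fm_size B + 1"
| "fm_size (DisM m A B) = fm_size A + fm_size B + 1"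
| "fm_size (Imp A B) = fm_size A + fm_size B + 1"

text \<open>No atom occurs under a negation or in the antecedent of an implication.\<close>

primrec monotone_fm :: "('a, 'm) fm \<Rightarrow> bool" where
  "monotone_fm (Atom p) \<longleftrightarrow> True"
| "monotone_fm (TopM m) \<longleftrightarrow> True"
| "monotone_fm (BotM m) \<longleftrightarrow> True"
| "monotone_fm (Neg A) \<longleftrightarrow> V A = {}"
| "monotone_fm (ConM m A B) \<longleftrightarrow> monotone_fm A \<and> monotone_fm B"
| "monotone_fm (DisM m A B) \<longleftrightarrow> monotone_fm A \<and> monotone_fm B"
| "monotone_fm (Imp A B) \<longleftrightarrow> V A = {} \<and> monotone_fm B"

definition monotone_mset :: "('a, 'm) fm multiset \<Rightarrow> bool" where
  "monotone_mset \<Gamma> \<longleftrightarrow> (\<forall>A\<in>#\<Gamma>. monotone_fm A)"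

type_synonym 'f sequent = "'f multiset \<times> 'f multiset"

abbreviation (input) Sequent :: "'f multiset \<Rightarrow> 'f multiset \<Rightarrow> 'f sequent" (infix "\<leadsto>" 55)
  where "\<Gamma> \<leadsto> \<Delta> \<equiv> (\<Gamma>, \<Delta>)"

type_synonym 'm form = "(nat, 'm) fm"

text \<open>
  Meta-formulas are built from atoms and formula variables, so \<^const>\<open>V\<close> of a meta-formula collects
  both. Meta-sequents may in addition contain meta-multiset variables (\<open>Ctx\<close>).
\<close>

datatype meta_atom = PAtom nat | FVar nat

type_synonym 'm meta_form = "(meta_atom, 'm) fm"

datatype 'm meta_item = Fm "'m meta_form" | Ctx nat

type_synonym 'm meta_sequent = "'m meta_item sequent"

primrec subst_fm :: "(nat \<Rightarrow> 'm form) \<Rightarrow> 'm meta_form \<Rightarrow> 'm form" where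
  "subst_fm \<sigma> (Atom a) = (case a of PAtom p \<Rightarrow> Atom p | FVar x \<Rightarrow> \<sigma> x)"
| "subst_fm \<sigma> (TopM m) = TopM m"
| "subst_fm \<sigma> (BotM m) = BotM m"
| "subst_fm \<sigma> (Neg A) = Neg (subst_fm \<sigma> A)"
| "subst_fm \<sigma> (ConM m A B) = ConM m (subst_fm \<sigma> A) (subst_fm \<sigma> B)"
| "subst_fm \<sigma> (DisM m A B) = DisM m (subst_fm \<sigma> A) (subst_fm \<sigma> B)"
| "subst_fm \<sigma> (Imp A B) = Imp (subst_fm \<sigma> A) (subst_fm \<sigma> B)"

primrec inst_item ::
  "(nat \<Rightarrow> 'm form) \<Rightarrow> (nat \<Rightarrow> 'm form multiset) \<Rightarrow> 'm meta_item \<Rightarrow> 'm form multiset" where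
  "inst_item \<sigma> \<tau> (Fm A) = {#subst_fm \<sigma> A#}"
| "inst_item \<sigma> \<tau> (Ctx X) = \<tau> X"

definition inst ::
  "(nat \<Rightarrow> 'm form) \<Rightarrow> (nat \<Rightarrow> 'm form multiset) \<Rightarrow> 'm meta_sequent \<Rightarrow> 'm form sequent" where
  "inst \<sigma> \<tau> S =
    (\<Sum>\<^sub># (image_mset (inst_item \<sigma> \<tau>) (fst S)) \<leadsto> \<Sum>\<^sub># (image_mset (inst_item \<sigma> \<tau>) (snd S)))"

text \<open>A rule is a list of premises with a conclusion; axioms are the rules without premises.\<close>

type_synonym 'm rule = "'m meta_sequent list \<times> 'm meta_sequent"
type_synonym 'm calculus = "'m rule set"

datatype 'm proof_tree = Node (root: "'m form sequent") "'m proof_tree list"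

fun is_proof :: "'m calculus \<Rightarrow> 'm proof_tree \<Rightarrow> bool" where
  "is_proof G (Node S ts) \<longleftrightarrow>
    (\<exists>(ps, c)\<in>G. \<exists>\<sigma> \<tau>. S = inst \<sigma> \<tau> c \<and> map root ts = map (inst \<sigma> \<tau>) ps) \<and>
    (\<forall>t\<in>set ts. is_proof G t)"

definition provable :: "'m calculus \<Rightarrow> 'm form sequent \<Rightarrow> bool" (infix "\<turnstile>" 50) where
  "G \<turnstile> S \<longleftrightarrow> (\<exists>\<pi>. is_proof G \<pi> \<and> root \<pi> = S)"

text \<open>Number of symbols, the sequent arrow included.\<close>

definition sequent_size :: "('a, 'm) fm sequent \<Rightarrow> nat" where
  "sequent_size S = 1 + (\<Sum>A\<in>#fst S. fm_size A) + (\<Sum>A\<in>#snd S. fm_size A)"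

fun proof_size :: "'m proof_tree \<Rightarrow> nat" where
  "proof_size (Node S ts) = sequent_size S + sum_list (map proof_size ts)"

definition MALL :: "'m::mode calculus" where
  "MALL =
    (let A = Atom (FVar 0); B = Atom (FVar 1);
         \<Gamma> = Ctx 0; \<Delta> = Ctx 1; \<Gamma>' = Ctx 2; \<Delta>' = Ctx 3
     in {
      ([], {#Fm A#} \<leadsto> {#Fm A#}),
      ([], {#} \<leadsto> {#Fm One#}),
      ([], {#Fm Zero#} \<leadsto> {#}),
      ([], {#\<Gamma>#} \<leadsto> {#Fm Top, \<Delta>#}),
      ([], {#\<Gamma>, Fm Bot#} \<leadsto> {#\<Delta>#}),
      ([{#\<Gamma>#} \<leadsto> {#\<Delta>#}], {#\<Gamma>, Fm One#} \<leadsto> {#\<Delta>#}),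
      ([{#\<Gamma>#} \<leadsto> {#\<Delta>#}], {#\<Gamma>#} \<leadsto> {#Fm Zero, \<Delta>#}),
      ([{#\<Gamma>, Fm A#} \<leadsto> {#\<Delta>#}], {#\<Gamma>, Fm (And A B)#} \<leadsto> {#\<Delta>#}),
      ([{#\<Gamma>, Fm B#} \<leadsto> {#\<Delta>#}], {#\<Gamma>, Fm (And A B)#} \<leadsto> {#\<Delta>#}),
      ([{#\<Gamma>#} \<leadsto> {#Fm A, \<Delta>#}, {#\<Gamma>#} \<leadsto> {#Fm B, \<Delta>#}], {#\<Gamma>#} \<leadsto> {#Fm (And A B), \<Delta>#}),
      ([{#\<Gamma>, Fm A#} \<leadsto> {#\<Delta>#}, {#\<Gamma>, Fm B#} \<leadsto> {#\<Delta>#}], {#\<Gamma>, Fm (Or A B)#} \<leadsto> {#\<Delta>#}),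
      ([{#\<Gamma>#} \<leadsto> {#Fm A, \<Delta>#}], {#\<Gamma>#} \<leadsto> {#Fm (Or A B), \<Delta>#}),
      ([{#\<Gamma>#} \<leadsto> {#Fm B, \<Delta>#}], {#\<Gamma>#} \<leadsto> {#Fm (Or A B), \<Delta>#}),
      ([{#\<Gamma>, Fm A, Fm B#} \<leadsto> {#\<Delta>#}], {#\<Gamma>, Fm (Fusion A B)#} \<leadsto> {#\<Delta>#}),
      ([{#\<Gamma>#} \<leadsto> {#Fm A, \<Delta>#}, {#\<Gamma>'#} \<leadsto> {#Fm B, \<Delta>'#}],
        {#\<Gamma>, \<Gamma>'#} \<leadsto> {#Fm (Fusion A B), \<Delta>, \<Delta>'#}),
      ([{#\<Gamma>, Fm A#} \<leadsto> {#\<Delta>#}, {#\<Gamma>', Fm B#} \<leadsto> {#\<Delta>'#}],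
        {#\<Gamma>, \<Gamma>', Fm (Plus A B)#} \<leadsto> {#\<Delta>, \<Delta>'#}),
      ([{#\<Gamma>#} \<leadsto> {#Fm A, Fm B, \<Delta>#}], {#\<Gamma>#} \<leadsto> {#Fm (Plus A B), \<Delta>#}) })"

text \<open>
  As \<open>H\<close> need not contain any rules beyond its axioms, preservation of provable sequents must be
  understood relative to \<open>H\<close>: whatever the rules of \<open>M\<close> yield from \<open>H\<close>-provable sequents is
  \<open>H\<close>-provable. This is admissibility, not derivability, of the rules of \<open>M\<close>, and it does not ask
  for cut. The first conjunct is the absolute version and is implied by the second.
\<close>

definition extends :: "'m calculus \<Rightarrow> 'm calculus \<Rightarrow> bool" where
  "extends H M \<longleftrightarrow>
    (\<forall>S. M \<turnstile> S \<longrightarrow> H \<turnstile> S) \<and>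
    (\<forall>(ps, c)\<in>M. \<forall>\<sigma> \<tau>. (\<forall>p\<in>set ps. H \<turnstile> inst \<sigma> \<tau> p) \<longrightarrow> H \<turnstile> inst \<sigma> \<tau> c)"

inductive strongly_focused :: "'m meta_sequent \<Rightarrow> bool" where
  "strongly_focused ({#Fm A#} \<leadsto> {#Fm A#})"
| "V_mset \<alpha> = {} \<Longrightarrow> strongly_focused ({#} \<leadsto> image_mset Fm \<alpha>)"
| "strongly_focused (image_mset Fm \<beta> \<leadsto> {#})"
| "\<Gamma> \<noteq> \<Delta> \<Longrightarrow> strongly_focused (add_mset (Ctx \<Gamma>) (image_mset Fm \<phi>) \<leadsto> {#Ctx \<Delta>#})"
| "\<Gamma> \<noteq> \<Delta> \<Longrightarrow> V_mset \<phi> = {} \<Longrightarrow>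
    strongly_focused ({#Ctx \<Gamma>#} \<leadsto> add_mset (Ctx \<Delta>) (image_mset Fm \<phi>))"

definition strongly_focused_axioms :: "'m calculus \<Rightarrow> bool" where
  "strongly_focused_axioms G \<longleftrightarrow> (\<forall>(ps, c)\<in>G. ps = [] \<and> strongly_focused c)"

text \<open>The exponent \<open>e\<close> is uniform in \<open>k\<close>, the sequent and the proof (it may depend on \<open>G\<close>, \<open>H\<close>).\<close>

definition monotone_feasible_interpolation :: "'m calculus \<Rightarrow> 'm calculus \<Rightarrow> bool" where
  "monotone_feasible_interpolation G H \<longleftrightarrow>
    (\<exists>e. \<forall>k \<Sigma> \<Lambda> \<pi>. length \<Lambda> = k \<and> is_proof G \<pi> \<and> root \<pi> = (\<Sigma> \<leadsto> sum_list \<Lambda>) \<longrightarrow>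
      (\<exists>C. length C = k \<and>
        (\<forall>j<k. fm_size (C ! j) \<le> proof_size \<pi> ^ e) \<and>
        H \<turnstile> (\<Sigma> \<leadsto> mset C) \<and>
        (\<forall>j<k. H \<turnstile> ({#C ! j#} \<leadsto> \<Lambda> ! j)) \<and>
        (\<forall>j<k. V (C ! j) \<subseteq> V_mset \<Sigma> \<inter> V_mset (\<Lambda> ! j)) \<and>
        (monotone_mset \<Sigma> \<longrightarrow> (\<forall>j<k. monotone_fm (C ! j)))))"

end

theory Submission
  imports Defs
begin

text \<open>
  The succedent of every instance of a strongly focused axiom is a sum \<open>M + N\<close>, where the formulas
  of \<open>M\<close> occur in the antecedent or contain no atoms, and \<open>N\<close> is either empty or the value of a
  meta-multiset variable, hence replaceable by anything. Refine \<open>M + N = \<Lambda>\<^sub>1 + \<dots> + \<Lambda>\<^sub>k\<close> to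
  \<open>\<Lambda>\<^sub>j = M\<^sub>j + N\<^sub>j\<close> and let \<open>C\<^sub>j\<close> be the multiplicative disjunction of \<open>M\<^sub>j\<close> and a last disjunct \<open>Z\<close>,
  where \<open>Z = 0\<close> if \<open>N\<close> is empty and \<open>Z = \<bottom>\<close> otherwise. In the second case \<open>\<bottom>\<close> derives \<open>N\<^sub>j\<close>,
  which compensates for the missing weakening.
\<close>

lemma mset_add_eq_add_refinement:
  fixes A B M N :: "'a multiset"
  assumes "A + B = M + N"
  obtains A\<^sub>M A\<^sub>N B\<^sub>M B\<^sub>N where "A = A\<^sub>M + A\<^sub>N" "B = B\<^sub>M + B\<^sub>N" "M = A\<^sub>M + B\<^sub>M" "N = A\<^sub>N + B\<^sub>N"
proof
  show "B = (M - A) + (N - (A - M))"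
  proof (rule multiset_eqI)
    fix x
    have "count A x + count B x = count M x + count N x"
      using assms by (metis count_union)
    then show "count B x = count ((M - A) + (N - (A - M))) x"
      by simp
  qed
  have "A \<subseteq># M + N"
    by (simp flip: assms)
  then have "A - M \<subseteq># N"
    by (simp add: subset_eq_diff_conv add.commute)
  then show "N = (A - M) + (N - (A - M))"
    by simp
  show "A = A \<inter># M + (A - M)" "M = A \<inter># M + (M - A)"
    by (auto simp: multiset_eq_iff min_def)
qed

lemma mset_sum_list_eq_add_refinement:
  fixes Ls :: "'a multiset list"
  assumes "sum_list Ls = M + N"
  obtains Ms Ns where "length Ms = length Ns" "Ls = map2 (+) Ms Ns"
    "sum_list Ms = M" "sum_list Ns = N"
  using assms
proof (induction Ls arbitrary: M N thesis)
  case Nil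
  then show ?case by simp
next
  case (Cons L Ls)
  have "L + sum_list Ls = M + N"
    using Cons.prems(2) by simp
  then obtain L\<^sub>M L\<^sub>N M' N' where head: "L = L\<^sub>M + L\<^sub>N" and tail: "sum_list Ls = M' + N'"
    and M: "M = L\<^sub>M + M'" and N: "N = L\<^sub>N + N'"
    by (rule mset_add_eq_add_refinement)
  obtain Ms Ns where "length Ms = length Ns" "Ls = map2 (+) Ms Ns"
    "sum_list Ms = M'" "sum_list Ns = N'"
    using Cons.IH[OF _ tail] .
  then show ?case
    by (intro Cons.prems(1)[of "L\<^sub>M # Ms" "L\<^sub>N # Ns"]) (simp_all add: head M N)
qed

lemma mem_subseteq_mset_sum_list: "A \<in> set As \<Longrightarrow> A \<subseteq># sum_list As"
  by (induction As) (auto intro: subset_mset.add_increasing)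

lemma sum_image_mset_mono_mset:
  fixes f :: "'a \<Rightarrow> 'b::canonically_ordered_monoid_add"
  shows "A \<subseteq># B \<Longrightarrow> (\<Sum>x\<in>#A. f x) \<le> (\<Sum>x\<in>#B. f x)"
  by (auto simp: mset_subset_eq_exists_conv le_iff_add)

lemma less_double_imp_le_power2:
  fixes m n :: nat
  assumes "m < 2 * n"
  shows "m \<le> n ^ 2"
  using assms by (cases n) (simp_all add: power2_eq_square)

lemma fm_size_pos: "0 < fm_size A"
  by (cases A) auto

lemma fm_size_foldr_DisM_le:
  "fm_size (foldr (DisM m) As Z) \<le> 2 * (\<Sum>A\<in>#mset As. fm_size A) + fm_size Z"
proof (induction As)
  case (Cons A As)
  then show ?case using fm_size_pos[of A] by simp
qed simp

lemma V_foldr_DisM: "V (foldr (DisM m) As Z) = V_mset (mset As) \<union> V Z"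
  by (induction As) (auto simp: V_mset_def)

lemma monotone_foldr_DisM:
  "monotone_fm (foldr (DisM m) As Z) \<longleftrightarrow> monotone_mset (mset As) \<and> monotone_fm Z"
  by (induction As) (auto simp: monotone_mset_def)

lemma monotone_fm_closed: "V A = {} \<Longrightarrow> monotone_fm A"
  by (induction A) auto

lemma V_subst_fm:
  "V (subst_fm \<sigma> A) = (\<Union>a\<in>V A. case a of PAtom p \<Rightarrow> {p} | FVar x \<Rightarrow> V (\<sigma> x))"
  by (induction A) (auto split: meta_atom.splits)

lemma inst_image_Fm:
  "\<Sum>\<^sub># (image_mset (inst_item \<sigma> \<tau>) (image_mset Fm \<alpha>)) = image_mset (subst_fm \<sigma>) \<alpha>"
  by (induction \<alpha>) auto

definition interpolation_language :: "('a, 'm) fm multiset \<Rightarrow> ('a, 'm) fm set" where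
  "interpolation_language \<Sigma> = {A. V A \<subseteq> V_mset \<Sigma> \<and> (monotone_mset \<Sigma> \<longrightarrow> monotone_fm A)}"

lemma mem_interpolation_language: "A \<in># \<Sigma> \<Longrightarrow> A \<in> interpolation_language \<Sigma>"
  by (auto simp: interpolation_language_def V_mset_def monotone_mset_def)

lemma closed_in_interpolation_language: "V A = {} \<Longrightarrow> A \<in> interpolation_language \<Sigma>"
  by (simp add: interpolation_language_def monotone_fm_closed)

lemma subst_closed_subset_interpolation_language:
  "V_mset \<alpha> = {} \<Longrightarrow> set_mset (image_mset (subst_fm \<sigma>) \<alpha>) \<subseteq> interpolation_language \<Sigma>"
  by (auto simp: V_mset_def V_subst_fm intro!: closed_in_interpolation_language)

lemma foldr_DisM_in_interpolation_language:
  "set As \<subseteq> interpolation_language \<Sigma> \<Longrightarrow> Z \<in> interpolation_language \<Sigma> \<Longrightarrow>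
    foldr (DisM m) As Z \<in> interpolation_language \<Sigma>"
  by (auto simp: interpolation_language_def V_foldr_DisM monotone_foldr_DisM V_mset_def
      monotone_mset_def)

definition interpolant ::
  "'m calculus \<Rightarrow> 'm form multiset \<Rightarrow> 'm form multiset \<Rightarrow> 'm form \<Rightarrow> bool" where
  "interpolant H \<Sigma> \<Lambda> C \<longleftrightarrow>
    C \<in> interpolation_language \<Sigma> \<and> V C \<subseteq> V_mset \<Lambda> \<and> H \<turnstile> ({#C#} \<leadsto> \<Lambda>)"

definition interpolants ::
  "'m calculus \<Rightarrow> 'm form multiset \<Rightarrow> 'm form multiset list \<Rightarrow> 'm form list \<Rightarrow> bool" where
  "interpolants H \<Sigma> \<Lambda>s Cs \<longleftrightarrow> H \<turnstile> (\<Sigma> \<leadsto> mset Cs) \<and> list_all2 (interpolant H \<Sigma>) \<Lambda>s Cs"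

lemma monotone_feasible_interpolationI:
  assumes "\<And>\<Sigma> \<Lambda>s \<pi>. is_proof G \<pi> \<Longrightarrow> root \<pi> = (\<Sigma> \<leadsto> sum_list \<Lambda>s) \<Longrightarrow>
    \<exists>Cs. interpolants H \<Sigma> \<Lambda>s Cs \<and> (\<forall>C\<in>set Cs. fm_size C \<le> proof_size \<pi> ^ e)"
  shows "monotone_feasible_interpolation G H"
  unfolding monotone_feasible_interpolation_def
proof (intro exI[of _ e] allI impI, elim conjE)
  fix k \<Sigma> \<Lambda>s \<pi>
  assume k: "length \<Lambda>s = k" and "is_proof G \<pi>" "root \<pi> = (\<Sigma> \<leadsto> sum_list \<Lambda>s)"
  with assms obtain Cs where "interpolants H \<Sigma> \<Lambda>s Cs"
    and "\<forall>C\<in>set Cs. fm_size C \<le> proof_size \<pi> ^ e"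
    by blast
  then show "\<exists>C. length C = k \<and>
      (\<forall>j<k. fm_size (C ! j) \<le> proof_size \<pi> ^ e) \<and>
      H \<turnstile> (\<Sigma> \<leadsto> mset C) \<and>
      (\<forall>j<k. H \<turnstile> ({#C ! j#} \<leadsto> \<Lambda>s ! j)) \<and>
      (\<forall>j<k. V (C ! j) \<subseteq> V_mset \<Sigma> \<inter> V_mset (\<Lambda>s ! j)) \<and>
      (monotone_mset \<Sigma> \<longrightarrow> (\<forall>j<k. monotone_fm (C ! j)))"
    using k by (intro exI[of _ Cs])
      (auto simp: interpolants_def interpolant_def interpolation_language_def list_all2_conv_all_nth)
qed

lemma strongly_focused_axioms_proofE:
  assumes "strongly_focused_axioms G" "is_proof G \<pi>"
  obtains c \<sigma> \<tau> where "([], c) \<in> G" "strongly_focused c" "root \<pi> = inst \<sigma> \<tau> c"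
  using assms by (cases \<pi>) (auto simp: strongly_focused_axioms_def)

lemma sequent_size_root_le: "sequent_size (root \<pi>) \<le> proof_size \<pi>"
  by (cases \<pi>) simp

lemma strongly_focused_succedent:
  assumes "strongly_focused c" and inst_c: "inst \<sigma> \<tau> c = (\<Sigma> \<leadsto> \<Lambda>)"
  obtains (rigid) "set_mset \<Lambda> \<subseteq> interpolation_language \<Sigma>"
  | (flexible) M N where "\<Lambda> = M + N" "set_mset M \<subseteq> interpolation_language \<Sigma>"
      "\<And>\<Delta>. \<exists>\<tau>'. inst \<sigma> \<tau>' c = (\<Sigma> \<leadsto> M + \<Delta>)"
  using assms(1)
proof (cases rule: strongly_focused.cases
    [case_names identity right_closed left left_context right_context])
  case (identity A)
  then show ?thesis
    using inst_c by (intro rigid) (auto simp: inst_def mem_interpolation_language)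
next
  case (right_closed \<alpha>)
  then show ?thesis
    using inst_c subst_closed_subset_interpolation_language[of \<alpha> \<sigma> \<Sigma>]
    by (intro rigid) (auto simp: inst_def inst_image_Fm)
next
  case (left \<beta>)
  then show ?thesis
    using inst_c by (intro rigid) (auto simp: inst_def)
next
  case (left_context X Y \<phi>)
  have "inst \<sigma> (\<tau>(Y := \<Delta>)) c = (\<Sigma> \<leadsto> {#} + \<Delta>)" for \<Delta>
    using inst_c left_context by (auto simp: inst_def inst_image_Fm)
  then show ?thesis by (intro flexible[of "{#}" \<Lambda>]) auto
next
  case (right_context X Y \<phi>)
  show ?thesis
  proof (rule flexible)
    show "\<Lambda> = image_mset (subst_fm \<sigma>) \<phi> + \<tau> Y"
      using inst_c right_context by (auto simp: inst_def inst_image_Fm)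
    show "set_mset (image_mset (subst_fm \<sigma>) \<phi>) \<subseteq> interpolation_language \<Sigma>"
      using right_context(3) by (rule subst_closed_subset_interpolation_language)
    have "inst \<sigma> (\<tau>(Y := \<Delta>)) c = (\<Sigma> \<leadsto> image_mset (subst_fm \<sigma>) \<phi> + \<Delta>)" for \<Delta>
      using inst_c right_context by (auto simp: inst_def inst_image_Fm)
    then show "\<exists>\<tau>'. inst \<sigma> \<tau>' c = (\<Sigma> \<leadsto> image_mset (subst_fm \<sigma>) \<phi> + \<Delta>)" for \<Delta>
      by blast
  qed
qed

locale MALL_extension =
  fixes H :: "'m::mode calculus"
  assumes extends_MALL: "extends H MALL"
begin

lemma MALL_rule:
  assumes "(ps, c) \<in> MALL" "list_all (\<lambda>p. H \<turnstile> inst \<sigma> \<tau> p) ps"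
  shows "H \<turnstile> inst \<sigma> \<tau> c"
  using extends_MALL assms unfolding extends_def list_all_iff by blast

lemma provable_refl: "H \<turnstile> ({#A#} \<leadsto> {#A#})"
  using MALL_rule[of "[]" "{#Fm (Atom (FVar 0))#} \<leadsto> {#Fm (Atom (FVar 0))#}" "\<lambda>_. A"]
  by (simp add: MALL_def Let_def inst_def)

lemma provable_ZeroL: "H \<turnstile> ({#Zero#} \<leadsto> {#})"
  using MALL_rule[of "[]" "{#Fm Zero#} \<leadsto> {#}"]
  by (simp add: MALL_def Let_def inst_def)

lemma provable_BotL: "H \<turnstile> (add_mset Bot \<Gamma> \<leadsto> \<Delta>)"
  using MALL_rule[of "[]" "{#Ctx 0, Fm Bot#} \<leadsto> {#Ctx 1#}" _ "\<lambda>n. if n = 0 then \<Gamma> else \<Delta>"]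
  by (simp add: MALL_def Let_def inst_def)

lemma provable_ZeroR:
  assumes "H \<turnstile> (\<Gamma> \<leadsto> \<Delta>)"
  shows "H \<turnstile> (\<Gamma> \<leadsto> add_mset Zero \<Delta>)"
  using MALL_rule[of "[{#Ctx 0#} \<leadsto> {#Ctx 1#}]" "{#Ctx 0#} \<leadsto> {#Fm Zero, Ctx 1#}" _
      "\<lambda>n. if n = 0 then \<Gamma> else \<Delta>"] assms
  by (simp add: MALL_def Let_def inst_def)

lemma provable_PlusL:
  assumes "H \<turnstile> (add_mset A \<Gamma> \<leadsto> \<Delta>)" "H \<turnstile> (add_mset B \<Gamma>' \<leadsto> \<Delta>')"
  shows "H \<turnstile> (add_mset (Plus A B) (\<Gamma> + \<Gamma>') \<leadsto> \<Delta> + \<Delta>')"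
  using MALL_rule[of
      "[{#Ctx 0, Fm (Atom (FVar 0))#} \<leadsto> {#Ctx 1#}, {#Ctx 2, Fm (Atom (FVar 1))#} \<leadsto> {#Ctx 3#}]"
      "{#Ctx 0, Ctx 2, Fm (Plus (Atom (FVar 0)) (Atom (FVar 1)))#} \<leadsto> {#Ctx 1, Ctx 3#}"
      "\<lambda>n. if n = 0 then A else B"
      "\<lambda>n. if n = 0 then \<Gamma> else if n = 1 then \<Delta> else if n = 2 then \<Gamma>' else \<Delta>'"] assms
  by (simp add: MALL_def Let_def inst_def add_mset_commute)

lemma provable_PlusR:
  assumes "H \<turnstile> (\<Gamma> \<leadsto> add_mset A (add_mset B \<Delta>))"
  shows "H \<turnstile> (\<Gamma> \<leadsto> add_mset (Plus A B) \<Delta>)"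
  using MALL_rule[of
      "[{#Ctx 0#} \<leadsto> {#Fm (Atom (FVar 0)), Fm (Atom (FVar 1)), Ctx 1#}]"
      "{#Ctx 0#} \<leadsto> {#Fm (Plus (Atom (FVar 0)) (Atom (FVar 1))), Ctx 1#}"
      "\<lambda>n. if n = 0 then A else B" "\<lambda>n. if n = 0 then \<Gamma> else \<Delta>"] assms
  by (simp add: MALL_def Let_def inst_def add_mset_commute)

lemma provable_replicate_ZeroR:
  "H \<turnstile> (\<Gamma> \<leadsto> \<Delta>) \<Longrightarrow> H \<turnstile> (\<Gamma> \<leadsto> \<Delta> + replicate_mset n Zero)"
  by (induction n) (auto intro: provable_ZeroR)

lemma provable_foldr_PlusL:
  "H \<turnstile> (add_mset Z \<Gamma> \<leadsto> \<Delta>) \<Longrightarrow> H \<turnstile> (add_mset (foldr Plus As Z) \<Gamma> \<leadsto> mset As + \<Delta>)"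
proof (induction As)
  case (Cons A As)
  then show ?case
    using provable_PlusL[OF provable_refl[of A] Cons.IH] by simp
qed simp

lemma provable_foldr_PlusR:
  "H \<turnstile> (\<Gamma> \<leadsto> mset As + add_mset Z \<Delta>) \<Longrightarrow> H \<turnstile> (\<Gamma> \<leadsto> add_mset (foldr Plus As Z) \<Delta>)"
proof (induction As arbitrary: \<Delta>)
  case (Cons A As)
  have "H \<turnstile> (\<Gamma> \<leadsto> add_mset (foldr Plus As Z) (add_mset A \<Delta>))"
    using Cons.prems by (intro Cons.IH) (simp add: add_mset_commute)
  then show ?case
    by (simp add: add_mset_commute provable_PlusR)
qed simp

lemma provable_map_foldr_PlusR:
  assumes "H \<turnstile> (\<Gamma> \<leadsto> sum_list (map mset Ass) + replicate_mset (length Ass) Z + \<Delta>)"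
  shows "H \<turnstile> (\<Gamma> \<leadsto> mset (map (\<lambda>As. foldr Plus As Z) Ass) + \<Delta>)"
  using assms
proof (induction Ass arbitrary: \<Delta>)
  case (Cons As Ass)
  have "H \<turnstile> (\<Gamma> \<leadsto> mset (map (\<lambda>As. foldr Plus As Z) Ass) + (mset As + add_mset Z \<Delta>))"
    using Cons.prems by (intro Cons.IH) (simp add: ac_simps)
  then have "H \<turnstile> (\<Gamma> \<leadsto> mset As + add_mset Z (mset (map (\<lambda>As. foldr Plus As Z) Ass) + \<Delta>))"
    by (simp add: ac_simps)
  from provable_foldr_PlusR[OF this] show ?case
    by simp
qed simp

lemma interpolant_foldr_Plus:
  assumes "set As \<subseteq> interpolation_language \<Sigma>" "V Z = {}" "H \<turnstile> ({#Z#} \<leadsto> \<Delta>)"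
  shows "interpolant H \<Sigma> (mset As + \<Delta>) (foldr Plus As Z)"
  unfolding interpolant_def
proof (intro conjI)
  show "foldr Plus As Z \<in> interpolation_language \<Sigma>"
    using assms(1,2)
    by (intro foldr_DisM_in_interpolation_language closed_in_interpolation_language)
  show "V (foldr Plus As Z) \<subseteq> V_mset (mset As + \<Delta>)"
    using assms(2) by (auto simp: V_foldr_DisM V_mset_def)
  show "H \<turnstile> ({#foldr Plus As Z#} \<leadsto> mset As + \<Delta>)"
    using assms(3) by (rule provable_foldr_PlusL)
qed

lemma interpolants_if_succedent_split:
  assumes succedent: "sum_list \<Lambda>s = M + N"
    and language: "set_mset M \<subseteq> interpolation_language \<Sigma>"
    and "V Z = {}"
    and right: "\<And>n. H \<turnstile> (\<Sigma> \<leadsto> M + replicate_mset n Z)"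
    and left: "\<And>\<Delta>. \<Delta> \<subseteq># N \<Longrightarrow> H \<turnstile> ({#Z#} \<leadsto> \<Delta>)"
  obtains Cs where "interpolants H \<Sigma> \<Lambda>s Cs"
    "\<forall>C\<in>set Cs. fm_size C \<le> 2 * (\<Sum>A\<in>#M. fm_size A) + fm_size Z"
proof -
  obtain Ms Ns where lengths: "length Ms = length Ns"
    and \<Lambda>s: "\<Lambda>s = map2 (+) Ms Ns" and sums: "sum_list Ms = M" "sum_list Ns = N"
    using succedent by (rule mset_sum_list_eq_add_refinement)
  obtain Ass where Ms: "Ms = map mset Ass"
    using ex_map_conv[of Ms mset] ex_mset by metis
  have As_subset: "mset As \<subseteq># M" if "As \<in> set Ass" for As
    using that sums(1) by (auto simp: Ms intro: mem_subseteq_mset_sum_list)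
  define Cs where "Cs = map (\<lambda>As. foldr Plus As Z) Ass"
  have "H \<turnstile> (\<Sigma> \<leadsto> mset Cs)"
    using provable_map_foldr_PlusR[of \<Sigma> Ass Z "{#}"] right sums(1) by (simp add: Cs_def Ms)
  moreover have "list_all2 (interpolant H \<Sigma>) \<Lambda>s Cs"
  proof (rule list_all2_all_nthI)
    show "length \<Lambda>s = length Cs"
      using lengths by (simp add: \<Lambda>s Cs_def Ms)
    fix j assume "j < length \<Lambda>s"
    then have j_less: "j < length Ass" "j < length Ns"
      using lengths by (simp_all add: \<Lambda>s Ms)
    have "set (Ass ! j) \<subseteq> interpolation_language \<Sigma>"
      using set_mset_mono[OF As_subset[OF nth_mem[OF j_less(1)]]] language by simp
    moreover have "H \<turnstile> ({#Z#} \<leadsto> Ns ! j)"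
      using mem_subseteq_mset_sum_list[OF nth_mem[OF j_less(2)]] by (intro left) (simp add: sums)
    ultimately have "interpolant H \<Sigma> (mset (Ass ! j) + Ns ! j) (foldr Plus (Ass ! j) Z)"
      using \<open>V Z = {}\<close> by (intro interpolant_foldr_Plus)
    then show "interpolant H \<Sigma> (\<Lambda>s ! j) (Cs ! j)"
      using j_less by (simp add: \<Lambda>s Cs_def Ms)
  qed
  moreover have "fm_size (foldr Plus As Z) \<le> 2 * (\<Sum>A\<in>#M. fm_size A) + fm_size Z"
    if "As \<in> set Ass" for As
    using fm_size_foldr_DisM_le[of multiplicative As Z]
      sum_image_mset_mono_mset[OF As_subset[OF that], of fm_size] by linarith
  ultimately show thesis
    by (intro that[of Cs]) (auto simp: interpolants_def Cs_def)
qed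

lemma interpolants_strongly_focused:
  assumes "strongly_focused c" and prov: "\<And>\<sigma> \<tau>. H \<turnstile> inst \<sigma> \<tau> c"
    and inst_c: "inst \<sigma> \<tau> c = (\<Sigma> \<leadsto> sum_list \<Lambda>s)"
  obtains Cs where "interpolants H \<Sigma> \<Lambda>s Cs"
    "\<forall>C\<in>set Cs. fm_size C < 2 * sequent_size (\<Sigma> \<leadsto> sum_list \<Lambda>s)"
  using assms(1) inst_c
proof (cases rule: strongly_focused_succedent)
  case rigid
  show thesis
  proof (rule interpolants_if_succedent_split[OF _ rigid])
    show "sum_list \<Lambda>s = sum_list \<Lambda>s + {#}" and "V Zero = {}"
      by simp_all
    show "H \<turnstile> (\<Sigma> \<leadsto> sum_list \<Lambda>s + replicate_mset n Zero)" for n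
      using prov inst_c by (metis provable_replicate_ZeroR)
    show "H \<turnstile> ({#Zero#} \<leadsto> \<Delta>)" if "\<Delta> \<subseteq># {#}" for \<Delta>
      using that provable_ZeroL by simp
    fix Cs
    assume "interpolants H \<Sigma> \<Lambda>s Cs"
      "\<forall>C\<in>set Cs. fm_size C \<le> 2 * (\<Sum>A\<in>#sum_list \<Lambda>s. fm_size A) + fm_size Zero"
    then show thesis
      by (intro that[of Cs]) (auto simp: sequent_size_def)
  qed
next
  case (flexible M N)
  show thesis
  proof (rule interpolants_if_succedent_split[OF flexible(1,2)])
    show "V Bot = {}"
      by simp
    show "H \<turnstile> (\<Sigma> \<leadsto> M + replicate_mset n Bot)" for n
      using flexible(3) prov by metis
    show "H \<turnstile> ({#Bot#} \<leadsto> \<Delta>)" for \<Delta>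
      by (rule provable_BotL)
    fix Cs
    assume "interpolants H \<Sigma> \<Lambda>s Cs"
      "\<forall>C\<in>set Cs. fm_size C \<le> 2 * (\<Sum>A\<in>#M. fm_size A) + fm_size Bot"
    then show thesis
      by (intro that[of Cs]) (auto simp: flexible(1) sequent_size_def)
  qed
qed

end

theorem theorem5p12:
  fixes G H :: "'m::mode calculus"
  assumes "strongly_focused_axioms G"
    and "extends H MALL"
    and "\<forall>(ps, c)\<in>G. \<forall>\<sigma> \<tau>. H \<turnstile> inst \<sigma> \<tau> c"
  shows "monotone_feasible_interpolation G H"
proof (rule monotone_feasible_interpolationI)
  interpret MALL_extension H
    by unfold_locales (fact assms(2))
  fix \<Sigma> \<Lambda>s \<pi>
  assume "is_proof G \<pi>" and root: "root \<pi> = (\<Sigma> \<leadsto> sum_list \<Lambda>s)"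
  with assms(1) obtain c \<sigma> \<tau> where "([], c) \<in> G" and focused: "strongly_focused c"
    and inst_c: "inst \<sigma> \<tau> c = (\<Sigma> \<leadsto> sum_list \<Lambda>s)"
    by (metis strongly_focused_axioms_proofE)
  from \<open>([], c) \<in> G\<close> assms(3) have provable_c: "H \<turnstile> inst \<sigma> \<tau> c" for \<sigma> \<tau>
    by blast
  from focused provable_c inst_c obtain Cs where "interpolants H \<Sigma> \<Lambda>s Cs"
    and size: "\<forall>C\<in>set Cs. fm_size C < 2 * sequent_size (\<Sigma> \<leadsto> sum_list \<Lambda>s)"
    by (rule interpolants_strongly_focused)
  moreover have "fm_size C \<le> proof_size \<pi> ^ 2" if "C \<in> set Cs" for C
    using bspec[OF size that] sequent_size_root_le[of \<pi>] unfolding root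
    by (intro less_double_imp_le_power2) linarith
  ultimately show "\<exists>Cs. interpolants H \<Sigma> \<Lambda>s Cs \<and> (\<forall>C\<in>set Cs. fm_size C \<le> proof_size \<pi> ^ 2)"
    by blast
qed

end
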